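(* Let $V$ be a finite set, $f\colon 2^V\to\mathbb{R}_{\ge 0}$ a symmetric submodular function with $f(\emptyset)=0$, and $\mathcal{M}$ a matroid on $V$ of rank $k\ge 1$. The partition $\mathcal{P}_k$ returned by the greedy splitting algorithm on $(f,\mathcal{M})$ (described in the context) is feasible and satisfies $f(\mathcal{P}_k)\le (2-2/k)\,\mathrm{OPT}$, where $\mathrm{OPT}$ is the optimum value of the Submodular Matroid-constrained Partitioning problem for $(f,\mathcal{M})$.
   Context: $f$ is submodular if $f(A)+f(B)\ge f(A\cup B)+f(A\cap B)$ for all $A,B\subseteq V$, symmetric if $f(A)=f(V\setminus A)$ for all $A$. For a partition $\mathcal{P}$ of $V$, $f(\mathcal{P})=\sum_{X\in\mathcal{P}}f(X)$. Submodular Matroid-constrained Partitioning: given $f$ and a rank-$k$ matroid $\mathcal{M}=(V,\mathcal{I})$ with bases $\mathcal{B}$, a partition $\{V_1,\dots,V_k\}$ of $V$ is feasible if some $B\in\mathcal{B}$ has $|B\cap V_i|=1$ for all $i$; minimize $f(\mathcal{P})$ over feasible $\mathcal{P}$; $\mathrm{OPT}$ denotes the minimum. A transversal of a partition is a set containing exactly one element of each class. Greedy splitting algorithm: set $\mathcal{P}_1=\{V\}$. For $i=1,\dots,k-1$: among all pairs $(X,W)$ with $W\in\mathcal{P}_i$, $X\subseteq W$, such that some $I\in\mathcal{I}$ is a transversal of $(\mathcal{P}_i\setminus\{W\})\cup\{X,W\setminus X\}$, choose one minimizing $f(X)+f(W\setminus X)-f(W)$, and set $\mathcal{P}_{i+1}=(\mathcal{P}_i\setminus\{W\})\cup\{X,W\setminus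 X\}$. Return $\mathcal{P}_k$. *)

theory Defs
  imports Complex_Main "HOL-Library.Disjoint_Sets"
begin

locale matroid =
  fixes V :: "'a set" and I :: "'a set set"
  assumes finite_ground: "finite V"
    and indep_subset_ground: "A \<in> I \<Longrightarrow> A \<subseteq> V"
    and indep_empty: "{} \<in> I"
    and indep_hereditary: "A \<in> I \<Longrightarrow> B \<subseteq> A \<Longrightarrow> B \<in> I"
    and indep_augment:
      "A \<in> I \<Longrightarrow> B \<in> I \<Longrightarrow> card A < card B \<Longrightarrow> \<exists>x \<in> B - A. insert x A \<in> I"

definition bases :: "'a set set \<Rightarrow> 'a set set" where
  "bases I = {B \<in> I. \<forall>A \<in> I. B \<subseteq> A \<longrightarrow> A = B}"

definition matroid_rank :: "'a set set \<Rightarrow> nat" where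
  "matroid_rank I = Max (card ` I)"

definition submodular_on :: "'a set \<Rightarrow> ('a set \<Rightarrow> real) \<Rightarrow> bool" where
  "submodular_on V f \<longleftrightarrow>
     (\<forall>A B. A \<subseteq> V \<longrightarrow> B \<subseteq> V \<longrightarrow> f A + f B \<ge> f (A \<union> B) + f (A \<inter> B))"

definition symmetric_on :: "'a set \<Rightarrow> ('a set \<Rightarrow> real) \<Rightarrow> bool" where
  "symmetric_on V f \<longleftrightarrow> (\<forall>A. A \<subseteq> V \<longrightarrow> f A = f (V - A))"

definition partition_value :: "('a set \<Rightarrow> real) \<Rightarrow> 'a set set \<Rightarrow> real" where
  "partition_value f P = (\<Sum>X\<in>P. f X)"

definition feasible :: "'a set \<Rightarrow> 'a set set \<Rightarrow> 'a set set \<Rightarrow> bool" where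
  "feasible V I P \<longleftrightarrow>
     partition_on V P \<and> card P = matroid_rank I \<and>
     (\<exists>B \<in> bases I. \<forall>X \<in> P. card (B \<inter> X) = 1)"

definition OPT :: "('a set \<Rightarrow> real) \<Rightarrow> 'a set \<Rightarrow> 'a set set \<Rightarrow> real" where
  "OPT f V I = Min (partition_value f ` {P. feasible V I P})"

definition transversal :: "'a set \<Rightarrow> 'a set set \<Rightarrow> bool" where
  "transversal T P \<longleftrightarrow> T \<subseteq> \<Union>P \<and> (\<forall>X \<in> P. card (T \<inter> X) = 1)"

definition split_class :: "'a set set \<Rightarrow> 'a set \<Rightarrow> 'a set \<Rightarrow> 'a set set" where
  "split_class P X W = (P - {W}) \<union> {X, W - X}"

text \<open>The classes \<open>X\<close> and \<open>W - X\<close> of an admissible split are automatically nonempty,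
  since no set meets an empty class in exactly one element.\<close>

definition admissible_split :: "'a set set \<Rightarrow> 'a set set \<Rightarrow> 'a set \<times> 'a set \<Rightarrow> bool" where
  "admissible_split I P = (\<lambda>(X, W). W \<in> P \<and> X \<subseteq> W \<and>
     (\<exists>T \<in> I. transversal T (split_class P X W)))"

definition split_cost :: "('a set \<Rightarrow> real) \<Rightarrow> 'a set \<times> 'a set \<Rightarrow> real" where
  "split_cost f = (\<lambda>(X, W). f X + f (W - X) - f W)"

text \<open>\<open>greedy_splitting f V I i P\<close> holds iff \<open>P\<close> can arise as the \<open>i\<close>-th partition of the
  greedy splitting algorithm under some way of breaking ties among the minimizing pairs.\<close>

inductive greedy_splitting ::
  "('a set \<Rightarrow> real) \<Rightarrow> 'a set \<Rightarrow> 'a set set \<Rightarrow> nat \<Rightarrow> 'a set set \<Rightarrow> bool"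
  for f V I where
  init: "greedy_splitting f V I 1 {V}"
| step: "greedy_splitting f V I i P \<Longrightarrow>
    is_arg_min (split_cost f) (admissible_split I P) (X, W) \<Longrightarrow>
    greedy_splitting f V I (Suc i) (split_class P X W)"

end

theory Submission
  imports Defs
begin

text \<open>
  Let \<open>Q\<close> be an optimal partition. Splitting a class \<open>W\<close> by a set \<open>Y\<close> costs at most \<open>2 f Y\<close>, by
  submodularity and symmetry. It therefore suffices that, when the greedy partition \<open>P\<close> has
  \<open>i\<close> classes, one of the \<open>i\<close> cheapest classes of \<open>Q\<close> induces an admissible split of some class of
  \<open>P\<close>: then the \<open>i\<close>-th step costs at most twice the \<open>i\<close>-th smallest value of \<open>f\<close> on \<open>Q\<close>, and
  summing over all but the most expensive class of \<open>Q\<close> gives the factor \<open>2 - 2 / k\<close>.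

  Rado's theorem characterises the families with an independent transversal by
  \<open>card U \<le> rk (\<Union>U)\<close> for all subfamilies \<open>U\<close>. The subfamilies of \<open>P\<close> attaining equality (the
  tight ones) are closed under union, so there is a largest one, \<open>M\<close>; a split of a class
  outside \<open>M\<close> is admissible as soon as neither part lies in the span of \<open>\<Union>M\<close>. As this span
  contains at most \<open>card M\<close> elements of a base, a pigeonhole argument yields such a split.
\<close>

section \<open>Rank and span in a matroid\<close>

context matroid
begin

lemma finite_indep_family: "finite I"
  by (rule finite_subset[of _ "Pow V"]) (use indep_subset_ground finite_ground in auto)

lemma finite_indep: "J \<in> I \<Longrightarrow> finite J"
  using indep_subset_ground finite_ground finite_subset by metis

text \<open>Total on all sets, since only members of \<open>I\<close> inside \<open>A\<close> count;
  monotonicity and submodularity thus carry no side conditions.\<close>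

definition rk :: "'a set \<Rightarrow> nat" where
  "rk A = Max (card ` {J \<in> I. J \<subseteq> A})"

lemma card_le_rk: "J \<in> I \<Longrightarrow> J \<subseteq> A \<Longrightarrow> card J \<le> rk A"
  unfolding rk_def using finite_indep_family by (intro Max_ge) auto

lemma rk_witness: obtains J where "J \<in> I" "J \<subseteq> A" "card J = rk A"
proof -
  have "rk A \<in> card ` {J \<in> I. J \<subseteq> A}"
    unfolding rk_def using finite_indep_family indep_empty by (intro Max_in) auto
  then show ?thesis using that by auto
qed

lemma indep_extend_rk:
  assumes "J \<in> I" "J \<subseteq> A"
  obtains K where "K \<in> I" "J \<subseteq> K" "K \<subseteq> A" "card K = rk A"
proof -
  have "\<exists>K\<in>I. J \<subseteq> K \<and> K \<subseteq> A \<and> card K = rk A"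
    using assms
  proof (induction "rk A - card J" arbitrary: J rule: less_induct)
    case less
    show ?case
    proof (cases "card J = rk A")
      case False
      with card_le_rk[OF less.prems] have lt: "card J < rk A" by simp
      obtain M where M: "M \<in> I" "M \<subseteq> A" "card M = rk A" by (rule rk_witness)
      then obtain x where x: "x \<in> M - J" "insert x J \<in> I"
        using indep_augment[of J M] less.prems lt by auto
      have "card (insert x J) = Suc (card J)"
        using x finite_indep[OF less.prems(1)] by simp
      then have "\<exists>K\<in>I. insert x J \<subseteq> K \<and> K \<subseteq> A \<and> card K = rk A"
        using less.hyps[of "insert x J"] x M less.prems lt by auto
      then show ?thesis by blast
    qed (use less.prems in blast)
  qed
  then show ?thesis using that by blast
qed

lemma rk_mono: "A \<subseteq> B \<Longrightarrow> rk A \<le> rk B"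
  by (metis rk_witness card_le_rk subset_trans)

text \<open>Extend a maximum independent subset of the intersection to one of the union. Its traces
  on \<open>A\<close> and \<open>B\<close> are independent, and their overlap contains the starting
  set.\<close>

lemma rk_submodular: "rk (A \<union> B) + rk (A \<inter> B) \<le> rk A + rk B"
proof -
  obtain J where J: "J \<in> I" "J \<subseteq> A \<inter> B" "card J = rk (A \<inter> B)" by (rule rk_witness)
  then obtain K where K: "K \<in> I" "J \<subseteq> K" "K \<subseteq> A \<union> B" "card K = rk (A \<union> B)"
    using indep_extend_rk[of J "A \<union> B"] by auto
  have fin: "finite K" using K finite_indep by auto
  have "(K \<inter> A) \<union> (K \<inter> B) = K" using K by auto
  then have "card (K \<inter> A) + card (K \<inter> B) = card K + card ((K \<inter> A) \<inter> (K \<inter> B))"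
    using fin card_Un_Int[of "K \<inter> A" "K \<inter> B"] by simp
  moreover have "card J \<le> card ((K \<inter> A) \<inter> (K \<inter> B))"
    using J K fin by (intro card_mono) auto
  moreover have "card (K \<inter> A) \<le> rk A" "card (K \<inter> B) \<le> rk B"
    using K indep_hereditary by (auto intro!: card_le_rk)
  ultimately show ?thesis using J K by linarith
qed

text \<open>Diminishing returns; contrapositively, whatever lies in the span of \<open>Y\<close>
  lies in the span of every superset.\<close>

lemma rk_insert_gt_antimono:
  assumes "Y \<subseteq> S" "rk S < rk (insert x S)"
  shows "rk Y < rk (insert x Y)"
proof -
  have "x \<notin> S" using assms(2) by (auto simp: insert_absorb)
  then have "insert x Y \<union> S = insert x S" "insert x Y \<inter> S = Y" using assms(1) by auto
  then show ?thesis using rk_submodular[of "insert x Y" S] assms(2) by simp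
qed

text \<open>Elements of the span are added one at a time; each stays in the span of the enlarged set
  by diminishing returns.\<close>

lemma rk_union_closure:
  assumes "finite C" "\<And>x. x \<in> C \<Longrightarrow> rk (insert x S) = rk S"
  shows "rk (S \<union> C) = rk S"
  using assms
proof (induction rule: finite_induct)
  case (insert x C)
  then have "rk (S \<union> C) = rk S" "rk (insert x S) = rk S" by auto
  then have "\<not> rk (S \<union> C) < rk (insert x (S \<union> C))"
    using rk_insert_gt_antimono[of S "S \<union> C" x] by auto
  moreover have "rk (S \<union> C) \<le> rk (insert x (S \<union> C))" by (rule rk_mono) auto
  ultimately show ?case using \<open>rk (S \<union> C) = rk S\<close> by simp
qed simp

section \<open>Rado's theorem on independent transversals\<close>

text \<open>Induction on the total size of the sets. From a set with two distinct elements, at least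
  one of the two can be deleted without violating the rank condition. Once no set has two elements,
  the condition for all of \<open>J\<close> forces the chosen elements to be distinct and
  independent.\<close>

theorem rado:
  fixes A :: "'b \<Rightarrow> 'a set"
  assumes "finite J" "\<And>j. j \<in> J \<Longrightarrow> A j \<subseteq> V"
    and "\<And>K. K \<subseteq> J \<Longrightarrow> card K \<le> rk (\<Union>(A ` K))"
  shows "\<exists>t. (\<forall>j\<in>J. t j \<in> A j) \<and> inj_on t J \<and> t ` J \<in> I"
  using assms(2,3)
proof (induction "\<Sum>j\<in>J. card (A j)" arbitrary: A rule: less_induct)
  case less
  note sub = less.prems(1) and hall = less.prems(2)
  have fin: "finite (A j)" if "j \<in> J" for j
    using sub[OF that] finite_ground finite_subset by blast
  show ?case
  proof (cases "\<exists>j\<in>J. \<exists>x\<in>A j. \<exists>y\<in>A j. x \<noteq> y")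
    case True
    then obtain j x y where jxy: "j \<in> J" "x \<in> A j" "y \<in> A j" "x \<noteq> y" by auto
    define A' where "A' z = A(j := A j - {z})" for z
    have dec: "(\<Sum>i\<in>J. card (A' z i)) < (\<Sum>i\<in>J. card (A i))" if "z \<in> A j" for z
    proof (rule sum_strict_mono_ex1[OF \<open>finite J\<close>])
      show "\<forall>i\<in>J. card (A' z i) \<le> card (A i)"
        using fin by (auto simp: A'_def intro: card_mono)
      show "\<exists>i\<in>J. card (A' z i) < card (A i)"
        using jxy(1) that fin card_Diff1_less[of "A j" z]
        by (intro bexI[of _ j]) (simp_all add: A'_def)
    qed
    \<comment> \<open>A violating \<open>K\<close> must contain \<open>j\<close>, the only index
      whose set shrank. Dropping \<open>j\<close> lowers the cardinality by one, which turns the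
      strict violation into this bound.\<close>
    have bad: "\<exists>L. L \<subseteq> J - {j} \<and> rk (\<Union>(A ` L) \<union> (A j - {z})) \<le> card L"
      if K: "K \<subseteq> J" "\<not> card K \<le> rk (\<Union>(A' z ` K))" for z K
    proof -
      have "j \<in> K"
      proof (rule ccontr)
        assume "j \<notin> K"
        then have "\<Union>(A' z ` K) = \<Union>(A ` K)" by (auto simp: A'_def)
        then show False using hall[OF K(1)] K(2) by simp
      qed
      moreover have "\<Union>(A ` (K - {j})) \<union> (A j - {z}) = \<Union>(A' z ` K)"
        using \<open>j \<in> K\<close> by (auto simp: A'_def split: if_splits)
      moreover have "finite K" using K(1) \<open>finite J\<close> finite_subset by blast
      ultimately show ?thesis using K
        by (intro exI[of _ "K - {j}"]) (auto simp: card_Diff_singleton_if)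
    qed
    have "\<exists>z\<in>{x,y}. \<forall>K\<subseteq>J. card K \<le> rk (\<Union>(A' z ` K))"
    proof (rule ccontr)
      assume "\<not> ?thesis"
      then obtain K1 K2 where "K1 \<subseteq> J" "\<not> card K1 \<le> rk (\<Union>(A' x ` K1))"
          "K2 \<subseteq> J" "\<not> card K2 \<le> rk (\<Union>(A' y ` K2))" by auto
      then obtain L1 L2 where L: "L1 \<subseteq> J - {j}" "rk (\<Union>(A ` L1) \<union> (A j - {x})) \<le> card L1"
          "L2 \<subseteq> J - {j}" "rk (\<Union>(A ` L2) \<union> (A j - {y})) \<le> card L2" using bad by meson
      let ?S1 = "\<Union>(A ` L1) \<union> (A j - {x})" and ?S2 = "\<Union>(A ` L2) \<union> (A j - {y})"
      have finL: "finite L1" "finite L2" using L \<open>finite J\<close> finite_subset by blast+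
      \<comment> \<open>As \<open>x\<close> and \<open>y\<close> differ, \<open>A j - {x}\<close>
        and \<open>A j - {y}\<close> together cover \<open>A j\<close>. The rank condition for
        \<open>insert j (L1 \<union> L2)\<close> and for \<open>L1 \<inter> L2\<close> then exceeds
        by one what submodularity permits.\<close>
      have "card (insert j (L1 \<union> L2)) \<le> rk (\<Union>(A ` insert j (L1 \<union> L2)))"
        using L jxy by (intro hall) auto
      also have "\<dots> \<le> rk (?S1 \<union> ?S2)" using jxy by (intro rk_mono) auto
      finally have 1: "Suc (card (L1 \<union> L2)) \<le> rk (?S1 \<union> ?S2)"
        using L finL by (subst (asm) card_insert_disjoint) auto
      have "card (L1 \<inter> L2) \<le> rk (\<Union>(A ` (L1 \<inter> L2)))" using L by (intro hall) auto
      also have "\<dots> \<le> rk (?S1 \<inter> ?S2)" by (intro rk_mono) auto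
      finally show False using 1 rk_submodular[of ?S1 ?S2] card_Un_Int[OF finL] L by linarith
    qed
    then obtain z where z: "z \<in> {x,y}" "\<And>K. K \<subseteq> J \<Longrightarrow> card K \<le> rk (\<Union>(A' z ` K))" by blast
    have "A' z i \<subseteq> V" if "i \<in> J" for i using sub[OF that] by (auto simp: A'_def)
    then obtain t where "\<forall>i\<in>J. t i \<in> A' z i" "inj_on t J" "t ` J \<in> I"
      using less.hyps[of "A' z"] dec[of z] z jxy by blast
    moreover have "A' z i \<subseteq> A i" for i by (auto simp: A'_def)
    ultimately show ?thesis by blast
  next
    case False
    have "A j \<noteq> {}" if "j \<in> J" for j
    proof
      assume "A j = {}"
      obtain M where "M \<in> I" "M \<subseteq> {}" "card M = rk {}" by (rule rk_witness)
      then show False using hall[of "{j}"] that \<open>A j = {}\<close> by auto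
    qed
    then have "\<forall>j\<in>J. \<exists>x. x \<in> A j" by blast
    then obtain t where t: "\<And>j. j \<in> J \<Longrightarrow> t j \<in> A j" by metis
    then have "A j = {t j}" if "j \<in> J" for j using False that by blast
    then have im: "\<Union>(A ` J) = t ` J" by auto
    obtain M where M: "M \<in> I" "M \<subseteq> t ` J" "card M = rk (t ` J)" by (rule rk_witness)
    have "card J \<le> card M" using hall[of J] im M by simp
    moreover have "card M \<le> card (t ` J)" using M \<open>finite J\<close> by (intro card_mono) auto
    moreover have "card (t ` J) \<le> card J" using \<open>finite J\<close> by (rule card_image_le)
    ultimately have "card M = card (t ` J)" "card (t ` J) = card J" by auto
    then have "M = t ` J" "inj_on t J"
      using M(2) \<open>finite J\<close> by (simp_all add: card_subset_eq eq_card_imp_inj_on)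
    then show ?thesis using M t by blast
  qed
qed

lemma rado_transversal:
  assumes "finite P" "disjoint P" "\<Union>P \<subseteq> V"
    and "\<And>U. U \<subseteq> P \<Longrightarrow> card U \<le> rk (\<Union>U)"
  shows "\<exists>T\<in>I. transversal T P"
proof -
  obtain t where t: "\<forall>X\<in>P. t X \<in> X" "t ` P \<in> I"
    using rado[of P "\<lambda>X. X"] assms by auto
  have "t ` P \<inter> X = {t X}" if "X \<in> P" for X
    using t(1) that assms(2) by (auto dest: disjointD)
  then have "transversal (t ` P) P" using t(1) by (auto simp: transversal_def)
  then show ?thesis using t(2) by blast
qed

end

section \<open>Tight subfamilies and admissible splits\<close>

lemma card_transversal:
  assumes "transversal T P" "finite P" "disjoint P" "finite T"
  shows "card T = card P"
proof -
  have "T = (\<Union>X\<in>P. T \<inter> X)" using assms(1) by (auto simp: transversal_def)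
  then have "card T = card (\<Union>X\<in>P. T \<inter> X)" by simp
  also have "\<dots> = (\<Sum>X\<in>P. card (T \<inter> X))"
    using assms by (intro card_UN_disjoint) (auto dest: disjointD)
  also have "\<dots> = card P" using assms(1) by (simp add: transversal_def)
  finally show ?thesis .
qed

lemma transversal_subfamily: "transversal T P \<Longrightarrow> U \<subseteq> P \<Longrightarrow> transversal (T \<inter> \<Union>U) U"
proof -
  assume T: "transversal T P" "U \<subseteq> P"
  have "T \<inter> \<Union>U \<inter> X = T \<inter> X" if "X \<in> U" for X using that by auto
  then show ?thesis using T by (auto simp: transversal_def)
qed

context matroid
begin

text \<open>The easy direction of Rado's theorem: the part of \<open>T\<close> inside the classes of
  \<open>U\<close> is independent and has one element per class.\<close>

lemma card_le_rk_transversal: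
  assumes "transversal T P" "T \<in> I" "finite P" "disjoint P" "U \<subseteq> P"
  shows "card U \<le> rk (\<Union>U)"
proof -
  have "card (T \<inter> \<Union>U) = card U"
    using transversal_subfamily[OF assms(1,5)] assms finite_indep
    by (intro card_transversal) (auto intro: finite_subset pairwise_subset)
  moreover have "T \<inter> \<Union>U \<in> I" using assms(2) indep_hereditary by auto
  ultimately show ?thesis using card_le_rk[of "T \<inter> \<Union>U" "\<Union>U"] by auto
qed

text \<open>For two tight subfamilies, submodularity bounds the ranks of union and intersection from
  above by exactly the sum that the rank condition gives from below, so both are tight. A maximal
  tight subfamily therefore absorbs every other.\<close>

lemma maximal_tight_subfamily:
  assumes fin: "finite P" and disj: "disjoint P"
    and hall: "\<And>U. U \<subseteq> P \<Longrightarrow> card U \<le> rk (\<Union>U)"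
  obtains M where "M \<subseteq> P" "rk (\<Union>M) = card M"
    "\<And>U. U \<subseteq> P \<Longrightarrow> rk (\<Union>U) = card U \<Longrightarrow> U \<subseteq> M"
proof -
  define tight where "tight U \<longleftrightarrow> U \<subseteq> P \<and> rk (\<Union>U) = card U" for U
  have un: "tight (U \<union> U')" if "tight U" "tight U'" for U U'
  proof -
    have "\<Union>U \<inter> \<Union>U' = \<Union>(U \<inter> U')"
      using that disj by (fastforce simp: tight_def dest: disjointD)
    moreover have "finite U" "finite U'" using that fin by (auto simp: tight_def intro: finite_subset)
    ultimately have "rk (\<Union>(U \<union> U')) + rk (\<Union>(U \<inter> U')) \<le> card (U \<union> U') + card (U \<inter> U')"
      using that rk_submodular[of "\<Union>U" "\<Union>U'"] card_Un_Int[of U U'] by (simp add: tight_def)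
    moreover have "card (U \<union> U') \<le> rk (\<Union>(U \<union> U'))" "card (U \<inter> U') \<le> rk (\<Union>(U \<inter> U'))"
      by (rule hall; use that in \<open>auto simp: tight_def\<close>)+
    ultimately show ?thesis using that by (auto simp: tight_def)
  qed
  have "rk {} = 0" using rk_witness[of "{}"] by (metis card.empty subset_empty)
  then have "tight {}" by (simp add: tight_def)
  moreover have "finite {U. tight U}"
    by (rule finite_subset[of _ "Pow P"]) (auto simp: tight_def fin)
  ultimately obtain M where M: "tight M" "\<And>U. tight U \<Longrightarrow> M \<subseteq> U \<Longrightarrow> M = U"
    using finite_has_maximal[of "{U. tight U}"] by auto
  have "U \<subseteq> M" if "tight U" for U
    using M(2)[OF un[OF M(1) that]] by auto
  then show ?thesis using M(1) that by (auto simp: tight_def)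
qed

text \<open>Rado's condition is checked by how many of the two parts occur in \<open>U'\<close>, the
  rest being a family \<open>U\<close> of old classes.\<close>

lemma transversal_split_class:
  assumes fin: "finite P" and disj: "disjoint P" and PV: "\<Union>P \<subseteq> V"
    and hall: "\<And>U. U \<subseteq> P \<Longrightarrow> card U \<le> rk (\<Union>U)"
    and tight: "\<And>U. U \<subseteq> P \<Longrightarrow> rk (\<Union>U) = card U \<Longrightarrow> U \<subseteq> M"
    and W: "W \<in> P" "W \<notin> M"
    and X: "X \<subseteq> W"
    and x: "x \<in> X" "rk (\<Union>M) < rk (insert x (\<Union>M))"
    and y: "y \<in> W - X" "rk (\<Union>M) < rk (insert y (\<Union>M))"
  shows "\<exists>T\<in>I. transversal T (split_class P X W)"
proof (rule rado_transversal)
  show "finite (split_class P X W)" using fin by (auto simp: split_class_def)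
  show "\<Union>(split_class P X W) \<subseteq> V" using PV W X by (auto simp: split_class_def)
  have disjW: "Z \<inter> W = {}" if "Z \<in> P" "Z \<noteq> W" for Z
    using disj that W by (auto dest: disjointD)
  show "disjoint (split_class P X W)"
    unfolding split_class_def pairwise_def disjnt_def
    using disj disjW X by (fastforce simp: pairwise_def disjnt_def)
  fix U' assume U': "U' \<subseteq> split_class P X W"
  define U where "U = U' - {X, W - X}"
  have U: "U \<subseteq> P - {W}" using U' by (auto simp: U_def split_class_def)
  then have finU: "finite U" using fin finite_subset by blast
  \<comment> \<open>If \<open>U\<close> is tight it lies in \<open>M\<close>, so an element outside
    the span of \<open>\<Union>M\<close> raises its rank; if not, \<open>U\<close> already has one
    unit of slack.\<close>
  have one: "Suc (card U) \<le> rk (\<Union>U \<union> Z)"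
    if "z \<in> Z" "rk (\<Union>M) < rk (insert z (\<Union>M))" for z Z
  proof (cases "rk (\<Union>U) = card U")
    case True
    then have "U \<subseteq> M" using U by (intro tight) auto
    then have "rk (\<Union>U) < rk (insert z (\<Union>U))"
      using that(2) by (rule rk_insert_gt_antimono[OF Union_mono])
    also have "\<dots> \<le> rk (\<Union>U \<union> Z)" using that(1) by (intro rk_mono) blast
    finally show ?thesis using True by simp
  next
    case False
    moreover have "U \<subseteq> P" using U by blast
    ultimately have "card U < rk (\<Union>U)" using hall[of U] by simp
    also have "\<dots> \<le> rk (\<Union>U \<union> Z)" by (rule rk_mono) auto
    finally show ?thesis by simp
  qed
  consider "U' = U" | "U' = insert X U" "X \<notin> U" | "U' = insert (W - X) U" "W - X \<notin> U"
    | "U' = insert X (insert (W - X) U)"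
    by (auto simp: U_def)
  then show "card U' \<le> rk (\<Union>U')"
  proof cases
    case 1
    then show ?thesis using U hall[of U] by auto
  next
    case 2
    then show ?thesis using one[of x X] x finU by (auto simp: Un_commute)
  next
    case 3
    then show ?thesis using one[of y "W - X"] y finU by (auto simp: Un_commute)
  next
    case 4
    \<comment> \<open>Both parts together cover \<open>W\<close>. Since \<open>W\<close> is not in
      \<open>M\<close>, \<open>insert W U\<close> is not tight, and its slack pays for the extra
      class.\<close>
    have "card (insert W U) \<le> rk (\<Union>(insert W U))" using U W by (intro hall) auto
    moreover have "rk (\<Union>(insert W U)) \<noteq> card (insert W U)"
      using tight[of "insert W U"] U W by auto
    moreover have "card (insert W U) = Suc (card U)" using U finU by (subst card_insert_disjoint) auto
    moreover have "\<Union>U' = \<Union>(insert W U)" using 4 X by auto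
    moreover have "card U' \<le> Suc (Suc (card U))"
      using 4 finU card_insert_le_m1 by (simp add: card_insert_if)
    ultimately show ?thesis by simp
  qed
qed

text \<open>Among the elements of \<open>B\<close> in the classes of \<open>R\<close> and one further class, those outside the
  span of the maximal tight subfamily outnumber the remaining classes of \<open>P\<close>, so two of them
  share such a class.\<close>

lemma exists_admissible_split:
  assumes P: "partition_on V P" and T: "T \<in> I" "transversal T P"
    and Q: "partition_on V Q" and B: "B \<in> I" "transversal B Q"
    and R: "R \<subseteq> Q" "card R = card P" "card P < card Q"
  shows "\<exists>W Y. Y \<in> R \<and> admissible_split I P (W \<inter> Y, W)"
proof -
  have fin: "finite P" "finite Q" using finite_elements[OF finite_ground] P Q by auto
  have disj: "disjoint P" "disjoint Q" using P Q by (auto simp: partition_on_def)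
  have hall: "card U \<le> rk (\<Union>U)" if "U \<subseteq> P" for U
    using card_le_rk_transversal[OF T(2,1) fin(1) disj(1) that] .
  obtain M where M: "M \<subseteq> P" "rk (\<Union>M) = card M"
      "\<And>U. U \<subseteq> P \<Longrightarrow> rk (\<Union>U) = card U \<Longrightarrow> U \<subseteq> M"
    using maximal_tight_subfamily[OF fin(1) disj(1) hall] by blast
  have finM: "finite M" and finR: "finite R" using M R fin finite_subset by blast+
  define C where "C = {x \<in> V. rk (insert x (\<Union>M)) = rk (\<Union>M)}"
  have notC: "rk (\<Union>M) < rk (insert x (\<Union>M))" if "x \<in> V" "x \<notin> C" for x
    using that rk_mono[OF subset_insertI, of "\<Union>M" x] by (auto simp: C_def)
  have "rk (\<Union>M \<union> C) = rk (\<Union>M)"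
    using finite_ground by (intro rk_union_closure) (auto simp: C_def)
  have "R \<noteq> Q" using R by auto
  then obtain Z where Z: "Z \<in> Q" "Z \<notin> R" using R by auto
  define B' where "B' = B \<inter> \<Union>(insert Z R)"
  have B'I: "B' \<in> I" using B indep_hereditary by (auto simp: B'_def)
  have finB': "finite B'" using B'I finite_indep by auto
  have B'V: "B' \<subseteq> V" using B'I indep_subset_ground by auto
  have trB': "transversal B' (insert Z R)"
    unfolding B'_def using B Z R by (intro transversal_subfamily) auto
  have "disjoint (insert Z R)" using disj(2) Z R by (auto intro: pairwise_subset)
  then have cardB': "card B' = Suc (card P)"
    using card_transversal[OF trB'] finR finB' Z R by auto
  \<comment> \<open>\<open>C\<close> is the span of \<open>\<Union>M\<close>, of rank
    \<open>card M\<close>, and \<open>B'\<close> is independent with one element more than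
    \<open>P\<close> has classes.\<close>
  have "card (B' \<inter> C) \<le> rk (\<Union>M \<union> C)"
    using B'I indep_hereditary by (intro card_le_rk) auto
  then have "card (B' \<inter> C) \<le> card M"
    using \<open>rk (\<Union>M \<union> C) = rk (\<Union>M)\<close> M(2) by simp
  moreover have "card (B' - C) = card B' - card (B' \<inter> C)"
    using finB' by (intro card_Diff_subset_Int) auto
  moreover have "card (P - M) = card P - card M" using M finM by (simp add: card_Diff_subset)
  moreover have "card M \<le> card P" using M fin by (simp add: card_mono)
  ultimately have less: "card (P - M) < card (B' - C)" using cardB' by linarith
  have "\<exists>W\<in>P. b \<in> W" if "b \<in> V" for b using P that by (auto simp: partition_on_def)
  then obtain c where c: "\<And>b. b \<in> V \<Longrightarrow> c b \<in> P \<and> b \<in> c b" by metis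
  have MC: "\<Union>M \<subseteq> C"
  proof
    fix x assume x: "x \<in> \<Union>M"
    moreover have "x \<in> V" using x M(1) P by (auto simp: partition_on_def)
    ultimately show "x \<in> C"
      unfolding C_def by (metis (mono_tags, lifting) insert_absorb mem_Collect_eq)
  qed
  have "c ` (B' - C) \<subseteq> P - M" using c B'V MC by blast
  then have "card (c ` (B' - C)) < card (B' - C)"
    using less card_mono[of "P - M" "c ` (B' - C)"] fin by auto
  then have "\<not> inj_on c (B' - C)" using pigeonhole by blast
  then obtain b b' where bb: "b \<in> B' - C" "b' \<in> B' - C" "b \<noteq> b'" "c b = c b'"
    by (auto simp: inj_on_def)
  define W where "W = c b"
  have W: "W \<in> P" "W \<notin> M" "b \<in> W" "b' \<in> W"
    using bb c B'V MC unfolding W_def by blast+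
  have split: "admissible_split I P (W \<inter> Y, W)"
    if "u \<in> W" "v \<in> W" "u \<in> B' - C" "v \<in> B' - C" "u \<in> Y" "v \<notin> Y" for u v Y
  proof -
    have "rk (\<Union>M) < rk (insert u (\<Union>M))" "rk (\<Union>M) < rk (insert v (\<Union>M))"
      using that B'V by (auto intro!: notC)
    moreover have "\<Union>P \<subseteq> V" using P by (simp add: partition_on_def)
    ultimately have "\<exists>T\<in>I. transversal T (split_class P (W \<inter> Y) W)"
      using that W fin disj
      by (intro transversal_split_class[OF _ _ _ hall M(3), where x = u and y = v]) auto
    then show ?thesis using W by (auto simp: admissible_split_def)
  qed
  \<comment> \<open>As \<open>B'\<close> meets each class once, \<open>b\<close> and
    \<open>b'\<close> lie in different classes of \<open>insert Z R\<close>. At most one of these is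
    \<open>Z\<close>; the other is in \<open>R\<close> and separates \<open>b\<close> from
    \<open>b'\<close> within \<open>W\<close>.\<close>
  obtain Y where Y: "Y \<in> insert Z R" "b \<in> Y" using bb by (auto simp: B'_def)
  obtain Y' where Y': "Y' \<in> insert Z R" "b' \<in> Y'" using bb by (auto simp: B'_def)
  have apart: False if "X \<in> insert Z R" "b \<in> X" "b' \<in> X" for X
  proof -
    have "card (B' \<inter> X) = 1" using trB' that(1) by (auto simp: transversal_def)
    then obtain z where "B' \<inter> X = {z}" by (auto simp: card_1_singleton_iff)
    moreover have "b \<in> B' \<inter> X" "b' \<in> B' \<inter> X" using that(2,3) bb(1,2) by auto
    ultimately show False using bb(3) by simp
  qed
  have "b' \<notin> Y" "b \<notin> Y'" using apart Y Y' by blast+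
  moreover have "Y \<in> R \<or> Y' \<in> R" using Y Y' \<open>b' \<notin> Y\<close> by auto
  ultimately show ?thesis using split[of b b' Y] split[of b' b Y'] W bb Y Y' by blast
qed

end

section \<open>Cost and effect of a split\<close>

lemma symmetric_on_ground:
  assumes "symmetric_on V f" "f {} = 0"
  shows "f V = 0"
proof -
  have "f V = f (V - V)" using assms(1) unfolding symmetric_on_def by blast
  then show ?thesis using assms(2) by simp
qed

text \<open>Submodularity is applied to \<open>W\<close> with \<open>Y\<close>, to \<open>W\<close>
  with \<open>V - Y\<close>, and to the two resulting unions, which meet in \<open>W\<close> and
  jointly cover \<open>V\<close>. In the sum of the three inequalities the unions cancel;
  \<open>f V = 0\<close> and \<open>f (V - Y) = f Y\<close> leave the bound.\<close>

lemma split_cost_Int_le: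
  assumes sub: "submodular_on V f" and sym: "symmetric_on V f" and f0: "f {} = 0"
    and "W \<subseteq> V" "Y \<subseteq> V"
  shows "split_cost f (W \<inter> Y, W) \<le> 2 * f Y"
proof -
  have s: "f (A \<union> B) + f (A \<inter> B) \<le> f A + f B" if "A \<subseteq> V" "B \<subseteq> V" for A B
    using sub that by (auto simp: submodular_on_def)
  have "f (V - Y) = f Y" using sym assms(5) unfolding symmetric_on_def by metis
  moreover have "f V = 0" using symmetric_on_ground[OF sym f0] .
  moreover have "W - W \<inter> Y = W \<inter> (V - Y)" "(W \<union> Y) \<union> (W \<union> (V - Y)) = V"
      "(W \<union> Y) \<inter> (W \<union> (V - Y)) = W"
    using assms by auto
  ultimately show ?thesis
    using s[of W Y] s[of W "V - Y"] s[of "W \<union> Y" "W \<union> (V - Y)"] assms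
    by (auto simp: split_cost_def)
qed

lemma admissible_split_properties:
  assumes P: "partition_on V P" and fin: "finite P" and adm: "admissible_split I P (X, W)"
  shows "partition_on V (split_class P X W)" "card (split_class P X W) = Suc (card P)"
    and "partition_value f (split_class P X W) = partition_value f P + split_cost f (X, W)"
proof -
  obtain T where W: "W \<in> P" "X \<subseteq> W" and T: "transversal T (split_class P X W)"
    using adm by (auto simp: admissible_split_def)
  have "card (T \<inter> X) = 1" "card (T \<inter> (W - X)) = 1"
    using T by (auto simp: transversal_def split_class_def)
  then have ne: "X \<noteq> {}" "W - X \<noteq> {}" by (metis Int_empty_right card.empty zero_neq_one)+
  have disjW: "Z \<inter> W = {}" if "Z \<in> P" "Z \<noteq> W" for Z
    using P that W by (auto simp: partition_on_def dest: disjointD)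
  \<comment> \<open>Partitions are sets, so a coincidence among classes would lose a summand;
    nonemptiness of both parts excludes this.\<close>
  have dist: "X \<notin> P - {W}" "W - X \<notin> P - {W}" "X \<noteq> W - X"
    using disjW[of X] disjW[of "W - X"] ne W by auto
  show "partition_on V (split_class P X W)"
  proof (rule partition_onI)
    show "\<Union>(split_class P X W) = V" using P W by (auto simp: split_class_def partition_on_def)
    show "{} \<notin> split_class P X W" using P ne by (auto simp: split_class_def partition_on_def)
    show "disjnt p q" if pq: "p \<in> split_class P X W" "q \<in> split_class P X W" "p \<noteq> q" for p q
    proof -
      have old: "disjnt r s" if "r \<in> P" "s \<in> P" "r \<noteq> s" for r s
        using P that by (auto simp: partition_on_def pairwise_def)
      have new: "disjnt r s" "disjnt s r" if "r \<in> P - {W}" "s \<in> {X, W - X}" for r s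
        using disjW[of r] that W by (auto simp: disjnt_def)
      consider "p \<in> P - {W}" "q \<in> P - {W}" | "p \<in> P - {W}" "q \<in> {X, W - X}"
        | "p \<in> {X, W - X}" "q \<in> P - {W}" | "p \<in> {X, W - X}" "q \<in> {X, W - X}"
        using pq(1,2) unfolding split_class_def by blast
      then show ?thesis
      proof cases
        case 4
        then show ?thesis using pq(3) by (auto simp: disjnt_def)
      qed (use old new pq(3) in blast)+
    qed
  qed
  have eq: "split_class P X W = insert X (insert (W - X) (P - {W}))"
    by (auto simp: split_class_def)
  show "card (split_class P X W) = Suc (card P)"
    unfolding eq using dist fin card_Suc_Diff1[OF fin W(1)] by simp
  show "partition_value f (split_class P X W) = partition_value f P + split_cost f (X, W)"
    unfolding eq partition_value_def split_cost_def
    using dist fin W by (simp add: sum.remove[of P W])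
qed

section \<open>Feasibility and progress of the greedy algorithm\<close>

context matroid
begin

lemma finite_admissible_splits:
  assumes "finite P" "\<Union>P \<subseteq> V"
  shows "finite {s. admissible_split I P s}"
proof (rule finite_subset)
  show "{s. admissible_split I P s} \<subseteq> Pow V \<times> P"
    using assms by (auto simp: admissible_split_def)
  show "finite (Pow V \<times> P)" using assms finite_ground by simp
qed

lemma arg_min_split_exists:
  assumes P: "partition_on V P" and adm: "admissible_split I P s"
  shows "\<exists>X W. is_arg_min (split_cost f) (admissible_split I P) (X, W)"
proof -
  have "finite {s. admissible_split I P s}"
    using P finite_elements[OF finite_ground P]
    by (intro finite_admissible_splits) (auto simp: partition_on_def)
  then obtain s' where "is_arg_min (split_cost f) (\<lambda>s. s \<in> {s. admissible_split I P s}) s'"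
    using adm ex_is_arg_min_if_finite[of "{s. admissible_split I P s}" "split_cost f"] by blast
  then show ?thesis by (cases s') auto
qed

lemma card_le_matroid_rank: "J \<in> I \<Longrightarrow> card J \<le> matroid_rank I"
  unfolding matroid_rank_def using finite_indep_family by (intro Max_ge) auto

lemma card_eq_matroid_rank_imp_base:
  assumes "J \<in> I" "card J = matroid_rank I"
  shows "J \<in> bases I"
proof -
  have "K = J" if "K \<in> I" "J \<subseteq> K" for K
    using that card_le_matroid_rank[OF that(1)] card_subset_eq[of K J]
      card_mono[of K J] finite_indep assms by fastforce
  then show ?thesis using assms by (auto simp: bases_def)
qed

text \<open>Identifies feasibility with the condition maintained by the algorithm: an independent
  transversal of a partition into rank-many classes has full rank, hence is a base.\<close>

lemma feasible_iff_transversal: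
  "feasible V I P \<longleftrightarrow> partition_on V P \<and> card P = matroid_rank I \<and> (\<exists>T\<in>I. transversal T P)"
proof -
  have "B \<in> I \<and> B \<subseteq> \<Union>P" if "B \<in> bases I" "partition_on V P" for B
    using that indep_subset_ground by (auto simp: bases_def partition_on_def)
  moreover have "T \<in> bases I"
    if "T \<in> I" "transversal T P" "partition_on V P" "card P = matroid_rank I" for T
    using that card_transversal[of T P] finite_indep finite_elements[OF finite_ground]
    by (intro card_eq_matroid_rank_imp_base) (auto simp: partition_on_def)
  ultimately show ?thesis unfolding feasible_def transversal_def by blast
qed

text \<open>Take a base, make all its elements but \<open>b\<close> singleton classes, and put
  everything else into the class of \<open>b\<close>.\<close>

lemma feasible_exists:
  assumes "matroid_rank I \<ge> 1"
  shows "\<exists>P. feasible V I P"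
proof -
  have "matroid_rank I \<in> card ` I"
    unfolding matroid_rank_def using finite_indep_family indep_empty by (intro Max_in) auto
  then obtain B where B: "B \<in> I" "card B = matroid_rank I" by auto
  then obtain b where b: "b \<in> B" using assms by fastforce
  have BV: "B \<subseteq> V" and finB: "finite B" using B indep_subset_ground finite_indep by auto
  define Z where "Z = V - (B - {b})"
  define P where "P = insert Z ((\<lambda>x. {x}) ` (B - {b}))"
  have bZ: "b \<in> Z" using b BV by (auto simp: Z_def)
  have "partition_on V P"
    using bZ BV by (intro partition_onI) (auto simp: P_def Z_def disjnt_def)
  moreover have "card P = card B"
  proof -
    have "Z \<notin> (\<lambda>x. {x}) ` (B - {b})" using bZ by auto
    moreover have "card ((\<lambda>x. {x}) ` (B - {b})) = card (B - {b})"
      by (rule card_image) auto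
    ultimately show ?thesis unfolding P_def using finB card_Suc_Diff1[OF finB b] by simp
  qed
  moreover have "transversal B P"
  proof -
    have "B \<inter> Z = {b}" using b BV by (auto simp: Z_def)
    moreover have "B \<inter> {x} = {x}" if "x \<in> B" for x using that by auto
    ultimately show ?thesis using b bZ by (auto simp: transversal_def P_def)
  qed
  ultimately show ?thesis using B by (auto simp: feasible_iff_transversal)
qed

lemma greedy_splitting_invariant:
  assumes "greedy_splitting f V I i P" "matroid_rank I \<ge> 1"
  shows "partition_on V P \<and> card P = i \<and> (\<exists>T\<in>I. transversal T P)"
  using assms(1)
proof induction
  case init
  \<comment> \<open>A feasible partition supplies a nonempty independent set; any element of it
    forms an independent transversal of \<open>{V}\<close>.\<close>
  obtain Q where "feasible V I Q" using feasible_exists[OF assms(2)] by auto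
  then obtain T where Q: "partition_on V Q" "card Q \<ge> 1" and T: "T \<in> I" "transversal T Q"
    using assms(2) by (auto simp: feasible_iff_transversal)
  then obtain X where "X \<in> Q" by fastforce
  then have "card (T \<inter> X) = 1" using T by (auto simp: transversal_def)
  then obtain x where "x \<in> T" by (auto simp: card_1_singleton_iff)
  then have "{x} \<in> I" "x \<in> V" using T indep_hereditary indep_subset_ground by auto
  then have "transversal {x} {V}" "partition_on V {V}"
    by (auto simp: transversal_def partition_on_def)
  then show ?case using \<open>{x} \<in> I\<close> by auto
next
  case (step i P X W)
  then have adm: "admissible_split I P (X, W)" by (simp add: is_arg_min_def)
  show ?case
    using admissible_split_properties[OF _ _ adm] step.IH adm finite_elements[OF finite_ground]
    by (auto simp: admissible_split_def)
qed

text \<open>The algorithm never gets stuck: any \<open>i\<close> classes of any feasible partition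
  already induce an admissible split.\<close>

lemma greedy_splitting_arg_min_exists:
  assumes G: "greedy_splitting f V I i P" and i: "i < matroid_rank I"
  shows "\<exists>X W. is_arg_min (split_cost f) (admissible_split I P) (X, W)"
proof -
  have k: "matroid_rank I \<ge> 1" using i by simp
  obtain Q where "feasible V I Q" using feasible_exists[OF k] by auto
  then obtain B where Q: "partition_on V Q" "card Q = matroid_rank I" and B: "B \<in> I" "transversal B Q"
    by (auto simp: feasible_iff_transversal)
  obtain T where P: "partition_on V P" "card P = i" and T: "T \<in> I" "transversal T P"
    using greedy_splitting_invariant[OF G k] by auto
  obtain R where "R \<subseteq> Q" "card R = card P"
    using obtain_subset_with_card_n[of "card P" Q] i P Q by auto
  then obtain s where "admissible_split I P s"
    using exists_admissible_split[OF P(1) T Q(1) B, of R] P Q i by auto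
  then show ?thesis using arg_min_split_exists P(1) by blast
qed

lemma greedy_splitting_exists:
  assumes "1 \<le> i" "i \<le> matroid_rank I"
  shows "\<exists>P. greedy_splitting f V I i P"
  using assms
proof (induction i rule: dec_induct)
  case base
  show ?case using greedy_splitting.init by blast
next
  case (step i)
  then obtain P where P: "greedy_splitting f V I i P" by auto
  then obtain X W where "is_arg_min (split_cost f) (admissible_split I P) (X, W)"
    using greedy_splitting_arg_min_exists step.prems by fastforce
  then show ?case using greedy_splitting.step[OF P] by blast
qed

section \<open>The approximation guarantee\<close>

text \<open>\<open>R\<close> consists of \<open>i - 1\<close> cheapest classes of \<open>Q\<close>,
  one for each split made so far, and each split is charged to twice the value of its class.\<close>

lemma greedy_splitting_value_le:
  assumes sub: "submodular_on V f" and sym: "symmetric_on V f" and f0: "f {} = 0"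
    and feas: "feasible V I Q" and k: "matroid_rank I \<ge> 1"
    and G: "greedy_splitting f V I i P" and "i \<le> matroid_rank I"
  shows "\<exists>R\<subseteq>Q. Suc (card R) = i \<and> (\<forall>Y\<in>R. \<forall>Z\<in>Q - R. f Y \<le> f Z) \<and>
    partition_value f P \<le> 2 * (\<Sum>Y\<in>R. f Y)"
  using G \<open>i \<le> matroid_rank I\<close>
proof induction
  case init
  have "f V = 0" using symmetric_on_ground[OF sym f0] .
  then show ?case by (intro exI[of _ "{}"]) (auto simp: partition_value_def)
next
  case (step i P X W)
  obtain B where Q: "partition_on V Q" "card Q = matroid_rank I" and B: "B \<in> I" "transversal B Q"
    using feas by (auto simp: feasible_iff_transversal)
  have finQ: "finite Q" using finite_elements[OF finite_ground Q(1)] .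
  obtain R where R: "R \<subseteq> Q" "Suc (card R) = i" "\<forall>Y\<in>R. \<forall>Z\<in>Q - R. f Y \<le> f Z"
      "partition_value f P \<le> 2 * (\<Sum>Y\<in>R. f Y)"
    using step by auto
  have finR: "finite R" using R finQ finite_subset by blast
  obtain T where P: "partition_on V P" "card P = i" and T: "T \<in> I" "transversal T P"
    using greedy_splitting_invariant[OF step.hyps(1) k] by auto
  have finP: "finite P" using finite_elements[OF finite_ground P(1)] .
  have adm: "admissible_split I P (X, W)"
    and opt: "\<And>s. admissible_split I P s \<Longrightarrow> split_cost f (X, W) \<le> split_cost f s"
    using step.hyps by (auto simp: is_arg_min_linorder)
  have "Q - R \<noteq> {}" using R Q step.prems by auto
  then obtain m where m: "m \<in> Q - R" "\<And>Z. Z \<in> Q - R \<Longrightarrow> f m \<le> f Z"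
    using finQ ex_is_arg_min_if_finite[of "Q - R" f] by (auto simp: is_arg_min_linorder)
  \<comment> \<open>Adding a next cheapest class \<open>m\<close> gives exactly as many classes as
    \<open>P\<close> has. Whichever of them induces the admissible split costs no more than
    \<open>m\<close>.\<close>
  have cardR': "card (insert m R) = i" using m finR R by simp
  then obtain W' Y where WY: "Y \<in> insert m R" "admissible_split I P (W' \<inter> Y, W')"
    using exists_admissible_split[OF P(1) T Q(1) B, of "insert m R"] R P Q m step.prems by auto
  have "W' \<in> P" "Y \<in> Q" using WY R(1) m by (auto simp: admissible_split_def)
  then have "W' \<subseteq> V" "Y \<subseteq> V" using P(1) Q(1) unfolding partition_on_def by blast+
  then have "split_cost f (X, W) \<le> 2 * f Y"
    using opt[OF WY(2)] split_cost_Int_le[OF sub sym f0] by (metis order_trans)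
  also have "f Y \<le> f m" using WY R m by auto
  finally have "split_cost f (X, W) \<le> 2 * f m" by simp
  moreover have "partition_value f (split_class P X W) = partition_value f P + split_cost f (X, W)"
    using admissible_split_properties[OF P(1) finP adm] by simp
  ultimately have "partition_value f (split_class P X W) \<le> 2 * (\<Sum>Y\<in>insert m R. f Y)"
    using R m finR by simp
  then show ?case using cardR' R m by (intro exI[of _ "insert m R"]) auto
qed

lemma greedy_splitting_approx:
  assumes "submodular_on V f" "symmetric_on V f" "f {} = 0"
    and feas: "feasible V I Q" and k: "matroid_rank I = k" "k \<ge> 1"
    and G: "greedy_splitting f V I k P"
  shows "partition_value f P \<le> (2 - 2 / real k) * partition_value f Q"
proof -
  obtain R where R: "R \<subseteq> Q" "Suc (card R) = k" "\<forall>Y\<in>R. \<forall>Z\<in>Q - R. f Y \<le> f Z"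
      "partition_value f P \<le> 2 * sum f R"
    using greedy_splitting_value_le[OF assms(1-4) _ G] k by auto
  have Q: "partition_on V Q" "card Q = k" using feas k by (auto simp: feasible_def)
  have finQ: "finite Q" using finite_elements[OF finite_ground Q(1)] .
  then have finR: "finite R" using R finite_subset by blast
  \<comment> \<open>After \<open>k - 1\<close> splits only one class \<open>Z\<close>, a dearest
    one, is left uncharged. It is at least the average of \<open>Q\<close>, so \<open>R\<close>
    carries at most the fraction \<open>1 - 1 / k\<close> of the value.\<close>
  have "card (Q - R) = 1" using R Q finR by (simp add: card_Diff_subset)
  then obtain Z where Z: "Q - R = {Z}" by (auto simp: card_1_singleton_iff)
  then have val: "partition_value f Q = sum f R + f Z"
    using sum.subset_diff[OF R(1) finQ, of f] by (simp add: partition_value_def)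
  have "sum f R \<le> real (card R) * f Z" using R Z by (intro sum_bounded_above) auto
  moreover have "real (card R) = real k - 1" using R by auto
  ultimately have "real k * sum f R \<le> (real k - 1) * partition_value f Q"
    by (simp add: val algebra_simps)
  then have "2 * sum f R \<le> (2 - 2 / real k) * partition_value f Q"
    using k by (simp add: field_simps)
  then show ?thesis using R by linarith
qed

lemma finite_feasible: "finite {P. feasible V I P}"
proof (rule finite_subset)
  show "{P. feasible V I P} \<subseteq> Pow (Pow V)" by (auto simp: feasible_def partition_on_def)
qed (use finite_ground in simp)

end

theorem theorem2:
  fixes V :: "'a set" and f :: "'a set \<Rightarrow> real" and I :: "'a set set" and k :: nat
  assumes "finite V"
    and "\<And>A. A \<subseteq> V \<Longrightarrow> f A \<ge> 0"
    and "submodular_on V f"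
    and "symmetric_on V f"
    and "f {} = 0"
    and "matroid V I"
    and "matroid_rank I = k"
    and "k \<ge> 1"
  shows "(\<exists>P. greedy_splitting f V I k P) \<and>
    (\<forall>i P. 1 \<le> i \<and> i < k \<and> greedy_splitting f V I i P \<longrightarrow>
       (\<exists>X W. is_arg_min (split_cost f) (admissible_split I P) (X, W))) \<and>
    (\<forall>P. greedy_splitting f V I k P \<longrightarrow>
       feasible V I P \<and> partition_value f P \<le> (2 - 2 / real k) * OPT f V I)"
proof -
  interpret matroid V I by fact
  \<comment> \<open>The minimum over the finite nonempty set of feasible values is attained, so
    \<open>OPT\<close> is the value of an actual partition.\<close>
  have "OPT f V I \<in> partition_value f ` {P. feasible V I P}"
    unfolding OPT_def using finite_feasible feasible_exists assms(7,8) by (intro Min_in) auto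
  then obtain Q where Q: "feasible V I Q" "OPT f V I = partition_value f Q" by auto
  show ?thesis
  proof (intro conjI allI impI; (elim conjE)?)
    show "\<exists>P. greedy_splitting f V I k P" using greedy_splitting_exists assms(7,8) by auto
  next
    fix i P assume "i < k" "greedy_splitting f V I i P"
    then show "\<exists>X W. is_arg_min (split_cost f) (admissible_split I P) (X, W)"
      using greedy_splitting_arg_min_exists assms(7) by auto
  next
    fix P assume G: "greedy_splitting f V I k P"
    show "feasible V I P"
      using greedy_splitting_invariant[OF G] assms(7,8) by (simp add: feasible_iff_transversal)
    show "partition_value f P \<le> (2 - 2 / real k) * OPT f V I"
      using greedy_splitting_approx[OF assms(3-5) Q(1) assms(7,8) G] Q(2) by simp
  qed
qed

end
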